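(* Let $\mathcal{A}$ be an alphabet. A subset $X\subseteq\Sigma_{\mathcal{A}}$ is a shift space if and only if $X=X_{\mathcal{F}}$ for some subset $\mathcal{F}\subseteq\Sigma_{\mathcal{A}}^{\mathrm{fin}}$.
   Context: An alphabet is a set $\mathcal{A}$ (finite or infinite); $\mathbb{N}=\{1,2,3,\ldots\}$. Let $\mathcal{A}^0=\{\vec{0}\}$ ($\vec{0}$ the empty sequence) and $\Sigma_{\mathcal{A}}^{\mathrm{fin}}=\bigcup_{k=0}^\infty\mathcal{A}^k$ (its elements are called blocks), $\Sigma_{\mathcal{A}}^{\mathrm{inf}}=\mathcal{A}^{\mathbb{N}}$. Let $l(x)\in\{0,1,\ldots,\infty\}$ be the length of a sequence. The full shift $\Sigma_{\mathcal{A}}$: If $\mathcal{A}$ is infinite, $\Sigma_{\mathcal{A}}:=\Sigma_{\mathcal{A}}^{\mathrm{inf}}\sqcup\Sigma_{\mathcal{A}}^{\mathrm{fin}}$, topologized as follows. Let $\mathcal{A}_\infty=\mathcal{A}\cup\{\infty\}$ be the one-point compactification of the discrete space $\mathcal{A}$, let $X_{\mathcal{A}}=\mathcal{A}_\infty\times\mathcal{A}_\infty\times\cdots$ with the product topology, and let $Q:X_{\mathcal{A}}\to\Sigma_{\mathcal{A}}$ truncate a sequence just before the first occurrence of $\infty$ (so $Q(x)=\vec{0}$ if $x_1=\infty$, and $Q(x)=x$ if $\infty$ does not occur); give $\Sigma_{\mathcal{A}}$ the quotient topology from $Q$. If $\mathcal{A}$ is finite, $\Sigma_{\mathcal{A}}:=\mathcal{A}^{\mathbb{N}}$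 with the product topology ($\mathcal{A}$ discrete), so it contains no finite sequences. The shift map $\sigma:\Sigma_{\mathcal{A}}\to\Sigma_{\mathcal{A}}$ deletes the first entry of a sequence, with $\sigma(x)=\vec{0}$ if $l(x)\le 1$. Concatenation of a finite sequence $x$ with a sequence $y$ is written $xy$ ($x\vec 0=x$, $\vec 0y=y$). A subset $X\subseteq\Sigma_{\mathcal{A}}$ has the infinite-extension property if for every $x\in X$ with $l(x)<\infty$ the set $\{a\in\mathcal{A}: xay\in X\text{ for some }y\in\Sigma_{\mathcal{A}}\}$ is infinite. A shift space over $\mathcal{A}$ is a subset $X\subseteq\Sigma_{\mathcal{A}}$ that is closed, satisfies $\sigma(X)\subseteq X$, and has the infinite-extension property (the empty set is allowed). A subblock of a sequence $x$ is $u\in\Sigma_{\mathcal{A}}^{\mathrm{fin}}$ such that $x=yuz$ for some finite sequence $y$ and some (finite or infinite) sequence $z$; $\vec{0}$ is a subblock of every sequence. For $\mathcal{F}\subseteq\Sigma_{\mathcal{A}}^{\mathrm{fin}}$: $X^{\mathrm{inf}}_{\mathcal{F}}:=\{x\in\Sigma_{\mathcal{A}}^{\mathrm{inf}}:\text{no subblock of }x\text{ is in }\mathcal{F}\}$; $X^{\mathrm{fin}}_{\mathcal{F}}:=\{x\in\Sigma_{\mathcal{A}}^{\mathrm{fin}}:\text{there are infinitely many }a\in\mathcal{A}\text{ for which there exists }y\in\Sigma_{\mathcal{A}}^{\mathrm{inf}}\text{ with }xay\in X^{\mathrm{inf}}_{\mathcal{F}}\}$; $X_{\mathcal{F}}:=X^{\mathrm{inf}}_{\mathcal{F}}\cup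 X^{\mathrm{fin}}_{\mathcal{F}}$. *)

theory Defs
  imports "HOL-Analysis.Analysis" "HOL-Library.Omega_Words_Fun"
begin

section \<open>Sequences over an alphabet\<close>

text \<open>An alphabet is an arbitrary set \<open>A\<close> of elements of the type \<open>'a\<close>. A block is a list over \<open>A\<close>,
  and the empty sequence is \<open>FinSeq []\<close>. Infinite sequences are indexed from 0.\<close>

datatype 'a sequence = FinSeq "'a list" | InfSeq "'a word"

definition fin_seqs :: "'a set \<Rightarrow> 'a sequence set" where
  "fin_seqs A = FinSeq ` lists A"

definition inf_seqs :: "'a set \<Rightarrow> 'a sequence set" where
  "inf_seqs A = InfSeq ` {w. range w \<subseteq> A}"

definition full_shift :: "'a set \<Rightarrow> 'a sequence set" where
  "full_shift A = (if finite A then inf_seqs A else inf_seqs A \<union> fin_seqs A)"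

fun cat :: "'a list \<Rightarrow> 'a sequence \<Rightarrow> 'a sequence" where
  "cat u (FinSeq v) = FinSeq (u @ v)"
| "cat u (InfSeq w) = InfSeq (u \<frown> w)"

fun shift_map :: "'a sequence \<Rightarrow> 'a sequence" where
  "shift_map (FinSeq u) = FinSeq (tl u)"
| "shift_map (InfSeq w) = InfSeq (suffix 1 w)"


section \<open>The topology of the full shift\<close>

definition quotient_topology :: "'a topology \<Rightarrow> ('a \<Rightarrow> 'b) \<Rightarrow> 'b topology" where
  "quotient_topology T f =
     topology (\<lambda>U. U \<subseteq> f ` topspace T \<and> openin T {x \<in> topspace T. f x \<in> U})"

lemma openin_quotient_topology:
  "openin (quotient_topology T f) U \<longleftrightarrow>
     U \<subseteq> f ` topspace T \<and> openin T {x \<in> topspace T. f x \<in> U}"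
proof -
  have "istopology (\<lambda>U. U \<subseteq> f ` topspace T \<and> openin T {x \<in> topspace T. f x \<in> U})"
    unfolding istopology_def
  proof (intro conjI allI impI)
    fix U V
    assume "U \<subseteq> f ` topspace T \<and> openin T {x \<in> topspace T. f x \<in> U}"
      and "V \<subseteq> f ` topspace T \<and> openin T {x \<in> topspace T. f x \<in> V}"
    moreover have "{x \<in> topspace T. f x \<in> U \<inter> V} =
        {x \<in> topspace T. f x \<in> U} \<inter> {x \<in> topspace T. f x \<in> V}"
      by auto
    ultimately show "U \<inter> V \<subseteq> f ` topspace T" "openin T {x \<in> topspace T. f x \<in> U \<inter> V}"
      by auto
  next
    fix K
    assume K: "\<forall>U\<in>K. U \<subseteq> f ` topspace T \<and> openin T {x \<in> topspace T. f x \<in> U}"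
    then show "\<Union>K \<subseteq> f ` topspace T"
      by blast
    have "{x \<in> topspace T. f x \<in> \<Union>K} = (\<Union>U\<in>K. {x \<in> topspace T. f x \<in> U})"
      by auto
    with K show "openin T {x \<in> topspace T. f x \<in> \<Union>K}"
      by auto
  qed
  then show ?thesis
    by (simp add: quotient_topology_def topology_inverse')
qed

lemma topspace_quotient_topology [simp]: "topspace (quotient_topology T f) = f ` topspace T"
proof
  show "topspace (quotient_topology T f) \<subseteq> f ` topspace T"
    using openin_quotient_topology by (metis openin_topspace)
  have "{x \<in> topspace T. f x \<in> f ` topspace T} = topspace T"
    by auto
  then have "openin (quotient_topology T f) (f ` topspace T)"
    by (simp add: openin_quotient_topology)
  then show "f ` topspace T \<subseteq> topspace (quotient_topology T f)"
    by (rule openin_subset)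
qed

lemma quotient_map_quotient_topology: "quotient_map T (quotient_topology T f) f"
  by (simp add: quotient_map_def openin_quotient_topology)

text \<open>The letter \<open>\<infinity>\<close> is \<open>None\<close>.\<close>

definition truncate :: "'a option word \<Rightarrow> 'a sequence" where
  "truncate x =
     (if \<exists>n. x n = None then FinSeq (map (\<lambda>i. the (x i)) [0..<(LEAST n. x n = None)])
      else InfSeq (\<lambda>i. the (x i)))"

text \<open>For a finite alphabet, the constructor \<open>InfSeq\<close> is injective, so the quotient topology along it
  is the product topology transported to \<open>inf_seqs A\<close>.\<close>

definition shift_topology :: "'a set \<Rightarrow> 'a sequence topology" where
  "shift_topology A =
     (if finite A
      then quotient_topology (product_topology (\<lambda>_. discrete_topology A) UNIV) InfSeq
      else quotient_topology
        (product_topology (\<lambda>_. Alexandroff_compactification (discrete_topology A)) UNIV) truncate)"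

lemma truncate_image: "truncate ` {x. range x \<subseteq> insert None (Some ` A)} = inf_seqs A \<union> fin_seqs A"
proof (intro equalityI subsetI)
  fix s
  assume "s \<in> truncate ` {x. range x \<subseteq> insert None (Some ` A)}"
  then obtain x where x: "range x \<subseteq> insert None (Some ` A)" and s: "s = truncate x"
    by auto
  have *: "the (x i) \<in> A" if "x i \<noteq> None" for i
  proof -
    have "x i \<in> insert None (Some ` A)"
      using x by blast
    with that show ?thesis by auto
  qed
  show "s \<in> inf_seqs A \<union> fin_seqs A"
  proof (cases "\<exists>n. x n = None")
    case True
    have "the (x i) \<in> A" if "i < (LEAST n. x n = None)" for i
      using * not_less_Least[OF that] by blast
    then have "map (\<lambda>i. the (x i)) [0..<(LEAST n. x n = None)] \<in> lists A"
      by (auto simp: in_lists_conv_set)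
    with True show ?thesis
      by (simp add: s truncate_def fin_seqs_def)
  next
    case False
    then have "range (\<lambda>i. the (x i)) \<subseteq> A"
      using * by blast
    with False show ?thesis
      by (simp add: s truncate_def inf_seqs_def)
  qed
next
  fix s
  assume "s \<in> inf_seqs A \<union> fin_seqs A"
  then consider w where "s = InfSeq w" "range w \<subseteq> A" | u where "s = FinSeq u" "u \<in> lists A"
    by (auto simp: inf_seqs_def fin_seqs_def)
  then show "s \<in> truncate ` {x. range x \<subseteq> insert None (Some ` A)}"
  proof cases
    case 1
    then have "s = truncate (\<lambda>i. Some (w i))" "range (\<lambda>i. Some (w i)) \<subseteq> insert None (Some ` A)"
      by (auto simp: truncate_def)
    then show ?thesis by blast
  next
    case 2
    define x where "x = (\<lambda>i. if i < length u then Some (u ! i) else None)"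
    have "(LEAST n. x n = None) = length u"
      by (rule Least_equality) (auto simp: x_def split: if_splits)
    moreover have "\<exists>n. x n = None"
      by (auto simp: x_def)
    moreover have "map (\<lambda>i. the (x i)) [0..<length u] = u"
      by (rule nth_equalityI) (auto simp: x_def)
    ultimately have "s = truncate x"
      by (simp add: truncate_def 2)
    moreover have "range x \<subseteq> insert None (Some ` A)"
      using 2 by (auto simp: x_def)
    ultimately show ?thesis by blast
  qed
qed

lemma topspace_shift_topology [simp]: "topspace (shift_topology A) = full_shift A"
proof -
  have 1: "(UNIV \<rightarrow>\<^sub>E A) = {x :: 'a word. range x \<subseteq> A}"
    by auto
  have 2: "(UNIV \<rightarrow>\<^sub>E insert None (Some ` A)) = {x :: 'a option word. range x \<subseteq> insert None (Some ` A)}"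
    by (simp add: PiE_def Pi_def image_subset_iff)
  show ?thesis
    by (simp add: shift_topology_def full_shift_def 1 2 truncate_image) (simp add: inf_seqs_def)
qed


section \<open>Shift spaces\<close>

definition infinite_extension :: "'a set \<Rightarrow> 'a sequence set \<Rightarrow> bool" where
  "infinite_extension A X \<longleftrightarrow>
     (\<forall>u. FinSeq u \<in> X \<longrightarrow> infinite {a \<in> A. \<exists>y \<in> full_shift A. cat u (cat [a] y) \<in> X})"

definition shift_space :: "'a set \<Rightarrow> 'a sequence set \<Rightarrow> bool" where
  "shift_space A X \<longleftrightarrow>
     X \<subseteq> full_shift A \<and> closedin (shift_topology A) X \<and> shift_map ` X \<subseteq> X \<and>
     infinite_extension A X"

definition subblock :: "'a list \<Rightarrow> 'a sequence \<Rightarrow> bool" where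
  "subblock u x \<longleftrightarrow> (\<exists>y z. x = cat y (cat u z))"

definition avoid_inf :: "'a set \<Rightarrow> 'a list set \<Rightarrow> 'a sequence set" where
  "avoid_inf A F = {x \<in> inf_seqs A. \<not> (\<exists>u \<in> F. subblock u x)}"

definition avoid_fin :: "'a set \<Rightarrow> 'a list set \<Rightarrow> 'a sequence set" where
  "avoid_fin A F = {FinSeq u |u. u \<in> lists A \<and>
     infinite {a \<in> A. \<exists>y \<in> inf_seqs A. cat u (cat [a] y) \<in> avoid_inf A F}}"

definition avoid :: "'a set \<Rightarrow> 'a list set \<Rightarrow> 'a sequence set" where
  "avoid A F = avoid_inf A F \<union> avoid_fin A F"

end

theory Submission
  imports Defs
begin

text \<open>For a shift space \<open>X\<close> take as forbidden blocks all blocks that do not occur in \<open>X\<close>. An infinite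
  sequence whose prefixes all occur in \<open>X\<close> is a limit of elements of \<open>X\<close>; a block with infinitely many
  follower letters in \<open>X\<close> is a limit of its extensions, by compactness of \<open>A\<^sub>\<infinity>\<^sup>\<nat>\<close>. So closedness
  of \<open>X\<close> recovers both parts of \<open>avoid A F\<close>. Conversely, a point of \<open>A\<^sub>\<infinity>\<^sup>\<nat>\<close> lies over \<open>avoid A F\<close> iff,
  after each of its prefixes \<open>u\<close> in \<open>A\<close>, the next letter is a follower of \<open>u\<close>, or is \<open>\<infinity>\<close> and \<open>u\<close> has
  infinitely many followers. Each of these conditions is closed.\<close>

section \<open>Concatenation, the shift map and avoided blocks\<close>

lemma cat_Nil [simp]: "cat [] x = x"
  by (cases x) auto

lemma cat_cat [simp]: "cat u (cat v x) = cat (u @ v) x"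
  by (cases x) auto

lemma shift_map_cat_Cons [simp]: "shift_map (cat (a # u) x) = cat u x"
proof (cases x)
  case (InfSeq w)
  have "suffix 1 ((a # u) \<frown> w) = u \<frown> w"
    by (subst suffix_conc_fst) auto
  with InfSeq show ?thesis by simp
qed simp

lemma prefix_in_lists: "range w \<subseteq> A \<Longrightarrow> prefix n w \<in> lists A"
  by (auto simp: image_subset_iff)

lemma shift_invariant_cat:
  assumes "shift_map ` X \<subseteq> X" "cat u x \<in> X"
  shows "x \<in> X"
  using assms(2)
proof (induction u)
  case (Cons a u)
  then show ?case
    using assms(1) by (metis image_subset_iff shift_map_cat_Cons)
qed simp

lemma cat_in_inf_seqs_iff: "cat u x \<in> inf_seqs A \<longleftrightarrow> u \<in> lists A \<and> x \<in> inf_seqs A"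
  by (cases x) (auto simp: inf_seqs_def image_iff)

lemma subblock_cat: "subblock u x \<Longrightarrow> subblock u (cat v x)"
  unfolding subblock_def by (metis cat_cat)

lemma avoid_inf_cat: "cat v x \<in> avoid_inf A F \<Longrightarrow> x \<in> avoid_inf A F"
  using subblock_cat[of _ x v] by (auto simp: avoid_inf_def cat_in_inf_seqs_iff)

text \<open>A subblock of \<open>w\<close> ends at a finite position, so it already lies in a prefix
  and then also in an extension of that prefix which avoids \<open>F\<close>.\<close>

lemma avoid_inf_of_prefixes:
  assumes "range w \<subseteq> A" and "\<And>n. \<exists>z. cat (prefix n w) z \<in> avoid_inf A F"
  shows "InfSeq w \<in> avoid_inf A F"
proof -
  have "\<not> subblock u (InfSeq w)" if "u \<in> F" for u
  proof
    assume "subblock u (InfSeq w)"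
    then obtain y z where yz: "InfSeq w = cat (y @ u) z"
      by (auto simp: subblock_def)
    then obtain v where "w = (y @ u) \<frown> v"
      by (cases z) auto
    then have "prefix (length (y @ u)) w = y @ u"
      by (simp only: prefix_conc_length)
    then obtain z' where "cat (y @ u) z' \<in> avoid_inf A F"
      using assms(2)[of "length (y @ u)"] by auto
    moreover have "subblock u (cat (y @ u) z')"
      unfolding subblock_def by (metis cat_cat)
    ultimately show False
      using that by (auto simp: avoid_inf_def)
  qed
  then show ?thesis
    using assms(1) by (auto simp: avoid_inf_def inf_seqs_def)
qed

section \<open>Letters that may follow a block\<close>

definition followers :: "'a set \<Rightarrow> 'a list set \<Rightarrow> 'a list \<Rightarrow> 'a set" where
  "followers A F u = {a \<in> A. \<exists>y \<in> inf_seqs A. cat u (cat [a] y) \<in> avoid_inf A F}"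

lemma FinSeq_in_avoid_iff:
  "FinSeq u \<in> avoid A F \<longleftrightarrow> u \<in> lists A \<and> infinite (followers A F u)"
  by (auto simp: avoid_def avoid_fin_def avoid_inf_def inf_seqs_def followers_def)

lemma InfSeq_in_avoid_iff: "InfSeq w \<in> avoid A F \<longleftrightarrow> InfSeq w \<in> avoid_inf A F"
  by (auto simp: avoid_def avoid_fin_def)

text \<open>Turns being a follower into extendability of \<open>u @ [a]\<close>, the form that
  prefix arguments use; membership in \<open>avoid_inf\<close> supplies the conditions on the letter
  and the tail.\<close>

lemma in_followers_iff:
  assumes "u \<in> lists A"
  shows "a \<in> followers A F u \<longleftrightarrow> (\<exists>z. cat (u @ [a]) z \<in> avoid_inf A F)"
proof
  assume "\<exists>z. cat (u @ [a]) z \<in> avoid_inf A F"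
  then obtain z where z: "cat (u @ [a]) z \<in> avoid_inf A F" by blast
  then have "u @ [a] \<in> lists A \<and> z \<in> inf_seqs A"
    by (auto simp: avoid_inf_def cat_in_inf_seqs_iff simp del: in_lists_conv_set)
  with z show "a \<in> followers A F u"
    by (auto simp: followers_def)
qed (auto simp: followers_def)

text \<open>Being a follower at position \<open>n\<close> says that the prefix of length
  \<open>Suc n\<close> extends to an avoiding sequence; for all \<open>n\<close> together this is
  the hypothesis of \<open>avoid_inf_of_prefixes\<close>.\<close>

lemma InfSeq_in_avoid_inf_iff_followers:
  assumes "range w \<subseteq> A"
  shows "InfSeq w \<in> avoid_inf A F \<longleftrightarrow> (\<forall>n. w n \<in> followers A F (prefix n w))"
proof -
  have *: "w n \<in> followers A F (prefix n w) \<longleftrightarrow> (\<exists>z. cat (prefix (Suc n) w) z \<in> avoid_inf A F)" for n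
    using in_followers_iff[OF prefix_in_lists[OF assms], of "w n"] by simp
  show ?thesis
  proof
    assume "InfSeq w \<in> avoid_inf A F"
    then have "cat (prefix (Suc n) w) (InfSeq (suffix (Suc n) w)) \<in> avoid_inf A F" for n
      by (simp del: subseq_to_Suc)
    then show "\<forall>n. w n \<in> followers A F (prefix n w)"
      unfolding * by blast
  next
    assume R: "\<forall>n. w n \<in> followers A F (prefix n w)"
    show "InfSeq w \<in> avoid_inf A F"
    proof (rule avoid_inf_of_prefixes[OF assms])
      fix n
      have "w n \<in> followers A F (prefix n w)"
        using R by blast
      then obtain z where "cat (prefix (Suc n) w) z \<in> avoid_inf A F"
        using *[of n] by blast
      then have "cat (prefix n w) (cat [w n] z) \<in> avoid_inf A F"
        by simp
      then show "\<exists>z. cat (prefix n w) z \<in> avoid_inf A F" by blast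
    qed
  qed
qed

text \<open>An avoiding sequence that starts with \<open>u @ b # v\<close> also starts with
  \<open>u @ [b]\<close>. Thus a single follower of a block makes each letter of the block a
  follower of what precedes it.\<close>

lemma followers_of_extension:
  assumes "u @ b # v \<in> lists A" "a \<in> followers A F (u @ b # v)"
  shows "b \<in> followers A F u"
proof -
  obtain z where "cat ((u @ b # v) @ [a]) z \<in> avoid_inf A F"
    using assms(2) unfolding in_followers_iff[OF assms(1)] by blast
  then have "cat (u @ [b]) (cat (v @ [a]) z) \<in> avoid_inf A F"
    by simp
  moreover have "u \<in> lists A"
    using assms(1) by simp
  ultimately show ?thesis
    unfolding in_followers_iff[OF \<open>u \<in> lists A\<close>] by blast
qed


section \<open>Closed sets in countable powers\<close>

text \<open>A basic neighbourhood of \<open>w\<close> restricts only finitely many coordinates, so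
  it contains every point of the space that shares a long enough prefix with
  \<open>w\<close>.\<close>

lemma closedin_product_prefix_limit:
  fixes T :: "'b topology"
  assumes P: "closedin (product_topology (\<lambda>_. T) UNIV) P"
    and w: "range w \<subseteq> topspace T"
    and prefixes: "\<And>n. \<exists>x\<in>P. prefix n x = prefix n w"
  shows "w \<in> P"
proof (rule ccontr)
  assume "w \<notin> P"
  let ?T = "product_topology (\<lambda>_ :: nat. T) UNIV"
  have "openin ?T (topspace ?T - P)"
    using P by blast
  moreover have "w \<in> topspace ?T - P"
    using w \<open>w \<notin> P\<close> by auto
  ultimately have "\<exists>U. finite {i \<in> UNIV. U i \<noteq> topspace T} \<and> (\<forall>i\<in>UNIV. openin T (U i)) \<and>
      w \<in> Pi\<^sub>E UNIV U \<and> Pi\<^sub>E UNIV U \<subseteq> topspace ?T - P"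
    unfolding openin_product_topology_alt by blast
  then obtain U where fin: "finite {i. U i \<noteq> topspace T}" and wU: "w \<in> Pi\<^sub>E UNIV U"
    and sub: "Pi\<^sub>E UNIV U \<subseteq> topspace ?T - P"
    by auto
  obtain n where n: "\<And>i. U i \<noteq> topspace T \<Longrightarrow> i < n"
    using finite_nat_set_iff_bounded[THEN iffD1, OF fin] by auto
  obtain x where x: "x \<in> P" "prefix n x = prefix n w"
    using prefixes by blast
  have "x i \<in> U i" for i
  proof (cases "i < n")
    case True
    then have "x i = w i"
      using x(2) by (auto simp: subsequence_def)
    with wU show ?thesis by auto
  next
    case False
    with n have "U i = topspace T" by blast
    moreover have "x \<in> topspace ?T"
      using P x(1) closedin_subset by blast
    ultimately show ?thesis by auto
  qed
  then have "x \<in> Pi\<^sub>E UNIV U" by auto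
  with sub x(1) show False by blast
qed

lemma prefix_eq_iff: "prefix (length p) x = p \<longleftrightarrow> (\<forall>i<length p. x i = p ! i)"
  unfolding list_eq_iff_nth_eq by simp

text \<open>The constraint for \<open>p\<close> fails on an open box, because the letters of
  \<open>p\<close> are isolated and \<open>C p\<close> is closed. The complement is a union of such
  boxes, so \<open>L\<close> may be infinite.\<close>

lemma closedin_product_prefix_constraints:
  fixes T :: "'b topology"
  assumes isolated: "\<And>p a. p \<in> L \<Longrightarrow> a \<in> set p \<Longrightarrow> openin T {a}"
    and C: "\<And>p. p \<in> L \<Longrightarrow> closedin T (C p)"
  shows "closedin (product_topology (\<lambda>_. T) UNIV)
    {x. range x \<subseteq> topspace T \<and> (\<forall>p\<in>L. prefix (length p) x = p \<longrightarrow> x (length p) \<in> C p)}"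
    (is "closedin ?T ?P")
proof -
  \<comment> \<open>\<open>U p\<close> spans the box of all points that start with \<open>p\<close>
    and violate its constraint at the next coordinate.\<close>
  define U where "U p i =
    (if i < length p then {p ! i} else if i = length p then topspace T - C p else topspace T)"
    for p :: "'b list" and i
  have "openin ?T (Pi\<^sub>E UNIV (U p))" if "p \<in> L" for p
  proof (rule product_topology_basis)
    show "openin T (U p i)" for i
      using isolated[OF that] C[OF that] by (auto simp: U_def)
    show "finite {i. U p i \<noteq> topspace T}"
      by (rule finite_subset[of _ "{..length p}"]) (auto simp: U_def split: if_splits)
  qed
  then have "openin ?T (\<Union>p\<in>L. Pi\<^sub>E UNIV (U p))"
    by blast
  then have "closedin ?T (topspace ?T - (\<Union>p\<in>L. Pi\<^sub>E UNIV (U p)))"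
    by (rule closedin_diff[OF closedin_topspace])
  moreover have "?P = topspace ?T - (\<Union>p\<in>L. Pi\<^sub>E UNIV (U p))"
  proof -
    have top: "x \<in> topspace ?T \<longleftrightarrow> range x \<subseteq> topspace T" for x
      by (auto simp: PiE_iff)
    have U: "x \<in> Pi\<^sub>E UNIV (U p) \<longleftrightarrow> prefix (length p) x = p \<and> x (length p) \<notin> C p"
      if "range x \<subseteq> topspace T" for x p
      unfolding prefix_eq_iff using that by (auto simp: U_def PiE_iff image_subset_iff split: if_splits)
    show ?thesis
    proof (rule set_eqI)
      show "x \<in> ?P \<longleftrightarrow> x \<in> topspace ?T - (\<Union>p\<in>L. Pi\<^sub>E UNIV (U p))" for x
        unfolding Diff_iff top UN_iff mem_Collect_eq using U[of x] by blast
    qed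
  qed
  ultimately show ?thesis
    by (simp only:)
qed


section \<open>Closed subsets of the full shift\<close>

text \<open>Along a quotient map a set is closed iff its preimage is; this moves questions of
  closedness into the product.\<close>

lemma closedin_shift_topology_finite:
  assumes "finite A" "X \<subseteq> full_shift A"
  shows "closedin (shift_topology A) X \<longleftrightarrow>
    closedin (product_topology (\<lambda>_. discrete_topology A) UNIV) {w. range w \<subseteq> A \<and> InfSeq w \<in> X}"
proof -
  let ?T = "product_topology (\<lambda>_ :: nat. discrete_topology A) UNIV"
  have q: "quotient_map ?T (shift_topology A) InfSeq"
    using assms(1) by (simp add: shift_topology_def quotient_map_quotient_topology)
  have "closedin ?T {w \<in> topspace ?T. InfSeq w \<in> X} \<longleftrightarrow> closedin (shift_topology A) X"
    using q assms(2) unfolding quotient_map_closedin topspace_shift_topology by blast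
  moreover have "{w \<in> topspace ?T. InfSeq w \<in> X} = {w. range w \<subseteq> A \<and> InfSeq w \<in> X}"
    by (auto simp: PiE_iff)
  ultimately show ?thesis
    by simp
qed

lemma closedin_shift_topology_infinite:
  assumes "infinite A" "X \<subseteq> full_shift A"
  shows "closedin (shift_topology A) X \<longleftrightarrow>
    closedin (product_topology (\<lambda>_. Alexandroff_compactification (discrete_topology A)) UNIV)
      {x. range x \<subseteq> insert None (Some ` A) \<and> truncate x \<in> X}"
proof -
  let ?T = "product_topology (\<lambda>_ :: nat. Alexandroff_compactification (discrete_topology A)) UNIV"
  have q: "quotient_map ?T (shift_topology A) truncate"
    using assms(1) by (simp add: shift_topology_def quotient_map_quotient_topology)
  have "closedin ?T {x \<in> topspace ?T. truncate x \<in> X} \<longleftrightarrow> closedin (shift_topology A) X"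
    using q assms(2) unfolding quotient_map_closedin topspace_shift_topology by blast
  moreover have "{x \<in> topspace ?T. truncate x \<in> X} = {x. range x \<subseteq> insert None (Some ` A) \<and> truncate x \<in> X}"
    by (auto simp: PiE_iff image_subset_iff)
  ultimately show ?thesis
    by simp
qed

section \<open>Fibres of truncation and a section of it\<close>

lemma prefix_eq_map_Some_iff:
  "prefix (length u) x = map Some u \<longleftrightarrow> (\<forall>i<length u. x i = Some (u ! i))"
  unfolding prefix_eq_iff[of x "map Some u", unfolded length_map] by auto

text \<open>Describes the fibre over a block: with indices from 0 the first \<open>None\<close> sits
  at \<open>length u\<close>, and all later coordinates are free.\<close>

lemma truncate_eq_FinSeq_iff:
  "truncate x = FinSeq u \<longleftrightarrow> prefix (length u) x = map Some u \<and> x (length u) = None"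
proof
  assume L: "truncate x = FinSeq u"
  let ?n = "LEAST n. x n = None"
  have ex: "\<exists>n. x n = None"
    using L by (auto simp: truncate_def split: if_splits)
  with L have u: "u = map (\<lambda>i. the (x i)) [0..<?n]"
    by (simp add: truncate_def)
  have "x i \<noteq> None" if "i < ?n" for i
    using not_less_Least[OF that] .
  moreover have "x ?n = None"
    using ex by (rule LeastI_ex)
  moreover have len: "?n = length u"
    by (simp add: u)
  moreover have "u ! i = the (x i)" if "i < ?n" for i
    unfolding u using that by simp
  ultimately show "prefix (length u) x = map Some u \<and> x (length u) = None"
    unfolding prefix_eq_map_Some_iff len by simp
next
  assume R: "prefix (length u) x = map Some u \<and> x (length u) = None"
  have some: "x i = Some (u ! i)" if "i < length u" for i
    using R that by (simp add: prefix_eq_map_Some_iff)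
  have "(LEAST n. x n = None) = length u"
  proof (rule Least_equality)
    show "x (length u) = None"
      using R by blast
    show "length u \<le> i" if "x i = None" for i
      using some[of i] that by (cases "i < length u") auto
  qed
  moreover have "map (\<lambda>i. the (x i)) [0..<length u] = u"
    by (rule nth_equalityI) (auto simp: some)
  ultimately show "truncate x = FinSeq u"
    using R by (auto simp: truncate_def)
qed

lemma truncate_Some [simp]: "truncate (\<lambda>i. Some (w i)) = InfSeq w"
  by (simp add: truncate_def)

text \<open>The fibre over an infinite sequence is a single point, so in that case \<open>x\<close>
  itself is known.\<close>

lemma truncate_cases:
  obtains u where "truncate x = FinSeq u" | w where "x = (\<lambda>i. Some (w i))" "truncate x = InfSeq w"
proof (cases "truncate x")
  case (InfSeq w)
  then have "x = (\<lambda>i. Some (w i))"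
    by (auto simp: truncate_def split: if_splits)
  with InfSeq that(2) show ?thesis by blast
qed (use that in blast)

text \<open>A section of \<open>truncate\<close>: among the many points over a block it picks the
  one padded with \<open>None\<close>.\<close>

fun lift :: "'a sequence \<Rightarrow> 'a option word" where
  "lift (FinSeq u) = (\<lambda>i. if i < length u then Some (u ! i) else None)"
| "lift (InfSeq w) = (\<lambda>i. Some (w i))"

lemma truncate_lift [simp]: "truncate (lift s) = s"
  by (cases s) (auto simp: truncate_eq_FinSeq_iff prefix_eq_map_Some_iff)

lemma range_lift: "s \<in> full_shift A \<Longrightarrow> range (lift s) \<subseteq> insert None (Some ` A)"
  by (cases s) (auto simp: full_shift_def inf_seqs_def fin_seqs_def split: if_splits)

lemma lift_cat_nth: "i < length u \<Longrightarrow> lift (cat u z) i = Some (u ! i)"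
  by (cases z) (auto simp: nth_append)

lemma prefix_lift_cat: "prefix (length u) (lift (cat u z)) = map Some u"
  by (simp add: prefix_eq_map_Some_iff lift_cat_nth)

text \<open>The given elements of \<open>X\<close>, lifted to the product, agree with the lift of
  \<open>w\<close> on ever longer prefixes, and the preimage of \<open>X\<close> is closed
  there.\<close>

lemma closed_shift_prefix_limit:
  assumes "closedin (shift_topology A) X" and w: "range w \<subseteq> A"
    and prefixes: "\<And>n. \<exists>z. cat (prefix n w) z \<in> X"
  shows "InfSeq w \<in> X"
proof -
  have X: "X \<subseteq> full_shift A"
    using closedin_subset[OF assms(1)] by simp
  show ?thesis
  proof (cases "finite A")
    case True
    let ?P = "{w. range w \<subseteq> A \<and> InfSeq w \<in> X}"
    have "w \<in> ?P"
    proof (rule closedin_product_prefix_limit)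
      show "closedin (product_topology (\<lambda>_. discrete_topology A) UNIV) ?P"
        using assms(1) closedin_shift_topology_finite[OF True X] by simp
      show "range w \<subseteq> topspace (discrete_topology A)"
        using w by simp
      fix n
      obtain z where z: "cat (prefix n w) z \<in> X"
        using prefixes by blast
      \<comment> \<open>Over a finite alphabet the full shift contains no blocks, so the
        continuation \<open>z\<close> is infinite.\<close>
      with X True have *: "cat (prefix n w) z \<in> inf_seqs A"
        by (auto simp: full_shift_def)
      then obtain v where v: "z = InfSeq v"
        by (cases z) (auto simp: inf_seqs_def)
      show "\<exists>x\<in>?P. prefix n x = prefix n w"
        by (rule bexI[of _ "prefix n w \<frown> v"]) (use z * v in \<open>auto simp: inf_seqs_def\<close>)
    qed
    then show ?thesis by simp
  next
    case False
    let ?P = "{x. range x \<subseteq> insert None (Some ` A) \<and> truncate x \<in> X}"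
    have "(\<lambda>i. Some (w i)) \<in> ?P"
    proof (rule closedin_product_prefix_limit)
      show "closedin (product_topology (\<lambda>_. Alexandroff_compactification (discrete_topology A)) UNIV) ?P"
        using assms(1) closedin_shift_topology_infinite[OF False X] by simp
      show "range (\<lambda>i. Some (w i)) \<subseteq> topspace (Alexandroff_compactification (discrete_topology A))"
        using w by auto
      fix n
      obtain z where z: "cat (prefix n w) z \<in> X"
        using prefixes by blast
      then have "lift (cat (prefix n w) z) \<in> ?P"
        using range_lift[OF subsetD[OF X z]] by simp
      moreover have "prefix n (lift (cat (prefix n w) z)) = prefix n (\<lambda>i. Some (w i))"
        using prefix_lift_cat[of "prefix n w" z] by (simp add: subsequence_def comp_def)
      ultimately show "\<exists>x\<in>?P. prefix n x = prefix n (\<lambda>i. Some (w i))"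
        by blast
    qed
    then show ?thesis by simp
  qed
qed

text \<open>The lifts extending \<open>u\<close> form a compact set; its projection to the coordinate after \<open>u\<close> is a
  closed set containing infinitely many letters, and therefore also \<open>\<infinity>\<close>.\<close>

lemma closed_shift_infinite_followers:
  assumes "closedin (shift_topology A) X"
    and inf: "infinite {a \<in> A. \<exists>z. cat u (cat [a] z) \<in> X}"
  shows "FinSeq u \<in> X"
proof (rule ccontr)
  assume notin: "FinSeq u \<notin> X"
  have X: "X \<subseteq> full_shift A"
    using closedin_subset[OF assms(1)] by simp
  have "infinite A"
    using inf by (rule contrapos_nn) auto
  let ?K = "Alexandroff_compactification (discrete_topology A)"
  let ?T = "product_topology (\<lambda>_ :: nat. ?K) UNIV"
  define n where "n = length u"
  define P where "P = {x. range x \<subseteq> insert None (Some ` A) \<and> truncate x \<in> X}"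
  define S where "S i = (if i < n then {Some (u ! i)} else topspace ?K)" for i
  \<comment> \<open>\<open>Q\<close> consists of the points over \<open>X\<close> whose first
    \<open>n\<close> coordinates spell \<open>u\<close>.\<close>
  define Q where "Q = P \<inter> Pi\<^sub>E UNIV S"
  obtain a z where az: "cat u (cat [a] z) \<in> X"
    using infinite_imp_nonempty[OF inf] by blast
  have u: "u ! i \<in> A" if "i < n" for i
  proof -
    have "lift (cat u (cat [a] z)) i \<in> insert None (Some ` A)"
      using range_lift[OF subsetD[OF X az]] by blast
    with that show ?thesis
      by (simp add: lift_cat_nth n_def image_iff del: cat_cat)
  qed
  have "closedin ?T P"
    using assms(1) closedin_shift_topology_infinite[OF \<open>infinite A\<close> X] by (simp add: P_def)
  moreover have "closedin ?T (Pi\<^sub>E UNIV S)"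
  proof -
    have "closedin ?K (S i)" for i
    proof (cases "i < n")
      case True
      have "closedin ?K (Some ` {u ! i})"
        using u[OF True] unfolding closedin_Alexandroff_compactification_image_Some
        by (simp add: compactin_discrete_topology)
      with True show ?thesis
        by (simp add: S_def)
    next
      case False
      then have "S i = topspace ?K"
        by (simp add: S_def)
      then show ?thesis
        by (simp only: closedin_topspace)
    qed
    then show ?thesis
      by (simp add: closedin_product_topology)
  qed
  ultimately have "closedin ?T Q"
    unfolding Q_def by blast
  moreover have "compact_space ?T"
    by (simp add: compact_space_product_topology)
  ultimately have "compactin ?T Q"
    using closedin_compact_space by blast
  then have compact: "compactin ?K ((\<lambda>x. x n) ` Q)"
    by (rule image_compactin) (rule continuous_map_product_projection, rule UNIV_I)
  \<comment> \<open>With \<open>None\<close> directly after \<open>u\<close>, the point would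
    truncate to \<open>u\<close>, which is assumed to lie outside \<open>X\<close>.\<close>
  have "x n \<noteq> None" if "x \<in> Q" for x
  proof
    assume "x n = None"
    moreover have "prefix n x = map Some u"
    proof -
      have "x i = Some (u ! i)" if "i < n" for i
      proof -
        have "x i \<in> S i"
          using \<open>x \<in> Q\<close> unfolding Q_def by blast
        with that show ?thesis
          by (simp add: S_def)
      qed
      then show ?thesis
        by (simp add: prefix_eq_map_Some_iff n_def)
    qed
    ultimately have "truncate x = FinSeq u"
      by (simp add: truncate_eq_FinSeq_iff n_def)
    then show False
      using that notin by (auto simp: Q_def P_def)
  qed
  moreover have "x n \<in> insert None (Some ` A)" if "x \<in> Q" for x
    using that unfolding Q_def P_def by blast
  ultimately have "(\<lambda>x. x n) ` Q \<subseteq> Some ` A"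
    by blast
  then obtain B where B: "B \<subseteq> A" "(\<lambda>x. x n) ` Q = Some ` B"
    by (auto simp: subset_image_iff)
  \<comment> \<open>In a Hausdorff space the compact projection is closed. A closed set that misses
    \<open>None\<close> is compact in the discrete space of letters, hence finite.\<close>
  have "Hausdorff_space ?K"
    by (simp add: Hausdorff_space_Alexandroff_compactification locally_compact_space_discrete_topology)
  then have "closedin ?K (Some ` B)"
    using compact B(2) compactin_imp_closedin by metis
  then have "compactin (discrete_topology A) B"
    by simp
  then have "finite B"
    by (simp add: compactin_discrete_topology)
  \<comment> \<open>Each such letter is coordinate \<open>n\<close> of the lift of an extension, and
    this lift lies in \<open>Q\<close>.\<close>
  moreover have "{a \<in> A. \<exists>z. cat u (cat [a] z) \<in> X} \<subseteq> B"
  proof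
    fix a assume "a \<in> {a \<in> A. \<exists>z. cat u (cat [a] z) \<in> X}"
    then obtain z where z: "cat (u @ [a]) z \<in> X" by auto
    let ?x = "lift (cat (u @ [a]) z)"
    have nth: "?x i = Some ((u @ [a]) ! i)" if "i \<le> n" for i
      using that by (intro lift_cat_nth) (simp add: n_def)
    have "?x \<in> P"
      using z range_lift[OF subsetD[OF X z]] by (simp add: P_def)
    moreover from this have "?x \<in> Pi\<^sub>E UNIV S"
      using nth by (auto simp: S_def PiE_iff P_def n_def nth_append)
    ultimately have "?x n \<in> (\<lambda>x. x n) ` Q"
      by (auto simp: Q_def)
    then show "a \<in> B"
      using nth[of n] B by (auto simp: n_def)
  qed
  ultimately show False
    using inf finite_subset by blast
qed


section \<open>Shift spaces and forbidden blocks\<close>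

text \<open>The preimage in the product is rewritten as a family of prefix constraints, one for each
  block over \<open>A\<close>.\<close>

lemma closedin_avoid:
  assumes X: "avoid A F \<subseteq> full_shift A"
  shows "closedin (shift_topology A) (avoid A F)"
proof (cases "finite A")
  case True
  have "{w. range w \<subseteq> A \<and> InfSeq w \<in> avoid A F} =
      {w. range w \<subseteq> A \<and> (\<forall>p\<in>lists A. prefix (length p) w = p \<longrightarrow> w (length p) \<in> followers A F p)}"
    (is "?L = ?R")
  proof -
    \<comment> \<open>Positions of \<open>w\<close> are exchanged for blocks, since the index set of
      the constraints must not depend on \<open>w\<close>.\<close>
    have "(\<forall>n. w n \<in> followers A F (prefix n w)) \<longleftrightarrow>
        (\<forall>p\<in>lists A. prefix (length p) w = p \<longrightarrow> w (length p) \<in> followers A F p)"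
      if "range w \<subseteq> A" for w
    proof (intro iffI allI ballI impI)
      fix n
      assume "\<forall>p\<in>lists A. prefix (length p) w = p \<longrightarrow> w (length p) \<in> followers A F p"
      from bspec[OF this prefix_in_lists[OF that], of n] show "w n \<in> followers A F (prefix n w)"
        by simp
    qed metis
    then show ?thesis
      by (auto simp only: InfSeq_in_avoid_iff InfSeq_in_avoid_inf_iff_followers)
  qed
  moreover have "closedin (product_topology (\<lambda>_. discrete_topology A) UNIV) ?R"
    using closedin_product_prefix_constraints[of "lists A" "discrete_topology A" "followers A F"]
    by (auto simp: followers_def)
  ultimately show ?thesis
    by (simp add: closedin_shift_topology_finite[OF True X])
next
  case False
  let ?K = "Alexandroff_compactification (discrete_topology A)"
  define E where "E = followers A F"
  \<comment> \<open>The symbols allowed after \<open>p\<close>; \<open>map the\<close> recovers the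
    block from its image under \<open>Some\<close>.\<close>
  define C where "C p = (let E = E (map the p) in Some ` E \<union> (if infinite E then {None} else {}))"
    for p :: "'a option list"
  have C: "x \<in> C (map Some u) \<longleftrightarrow> x \<in> Some ` E u \<or> x = None \<and> infinite (E u)" for x u
    by (auto simp: C_def Let_def comp_def)
  have EA: "E u \<subseteq> A" for u
    by (auto simp: E_def followers_def)
  \<comment> \<open>Finitely many followers form a compact set of letters. Otherwise
    \<open>C p\<close> contains \<open>None\<close> and is the complement of a set of letters, which
    is open.\<close>
  have closed: "closedin ?K (C p)" for p
  proof (cases "finite (E (map the p))")
    case True
    then show ?thesis
      using EA by (simp add: C_def Let_def compactin_discrete_topology)
  next
    case False
    then have "C p = topspace ?K - Some ` (A - E (map the p))"
      using EA[of "map the p"] by (auto simp: C_def Let_def)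
    then show ?thesis
      unfolding closedin_Alexandroff_compactification
      by (metis Diff_subset openin_discrete_topology)
  qed
  have "{x. range x \<subseteq> insert None (Some ` A) \<and> truncate x \<in> avoid A F} =
      {x. range x \<subseteq> topspace ?K \<and>
        (\<forall>p\<in>map Some ` lists A. prefix (length p) x = p \<longrightarrow> x (length p) \<in> C p)}" (is "_ = ?R")
  proof -
    have "truncate x \<in> avoid A F \<longleftrightarrow>
        (\<forall>u\<in>lists A. prefix (length u) x = map Some u \<longrightarrow> x (length u) \<in> C (map Some u))"
      if x: "range x \<subseteq> insert None (Some ` A)" for x
    proof (cases rule: truncate_cases[of x])
      case (1 u)
      then have px: "prefix (length u) x = map Some u" "x (length u) = None"
        by (auto simp: truncate_eq_FinSeq_iff)
      have xu: "x i = Some (u ! i)" if "i < length u" for i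
        using px(1) that by (simp add: prefix_eq_map_Some_iff)
      have u: "u \<in> lists A"
      proof -
        have "map Some u \<in> lists (insert None (Some ` A))"
          unfolding px(1)[symmetric] by (rule prefix_in_lists[OF x])
        then show ?thesis by auto
      qed
      have "truncate x \<in> avoid A F \<longleftrightarrow> infinite (E u)"
        using u by (simp add: 1 FinSeq_in_avoid_iff E_def del: in_lists_conv_set)
      also have "\<dots> \<longleftrightarrow>
        (\<forall>v\<in>lists A. prefix (length v) x = map Some v \<longrightarrow> x (length v) \<in> C (map Some v))"
      proof (intro iffI ballI impI)
        fix v
        assume inf: "infinite (E u)" and v: "v \<in> lists A" "prefix (length v) x = map Some v"
        have xv: "x i = Some (v ! i)" if "i < length v" for i
          using v(2) that by (simp add: prefix_eq_map_Some_iff)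
        \<comment> \<open>A longer \<open>v\<close> would need a letter at index
          \<open>length u\<close>, where \<open>x\<close> has \<open>None\<close>.\<close>
        have le: "length v \<le> length u"
          using xv px(2) by (metis leI option.distinct(1))
        have v_eq: "v = take (length v) u"
          using xv xu le by (intro nth_equalityI) auto
        show "x (length v) \<in> C (map Some v)"
        proof (cases "length v = length u")
          case True
          with v_eq have "v = u" by simp
          with inf px(2) show ?thesis
            by (simp add: C)
        next
          case False
          with le have lt: "length v < length u" by simp
          then have split: "u = v @ u ! length v # drop (Suc (length v)) u"
            using v_eq id_take_nth_drop by metis
          \<comment> \<open>At a proper prefix of \<open>u\<close> a single follower of
            \<open>u\<close> is enough, by \<open>followers_of_extension\<close>.\<close>
          obtain a where "a \<in> E u"
            using inf by (metis finite.emptyI ex_in_conv)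
          then have "u ! length v \<in> E v"
            using followers_of_extension[of v "u ! length v" "drop (Suc (length v)) u" A a F] split u
            by (simp add: E_def del: in_lists_conv_set)
          with lt xu show ?thesis
            by (simp add: C)
        qed
      next
        assume "\<forall>v\<in>lists A. prefix (length v) x = map Some v \<longrightarrow> x (length v) \<in> C (map Some v)"
        \<comment> \<open>Conversely, the constraint at \<open>u\<close> itself is the decisive one:
          it allows \<open>None\<close> only after a block with infinitely many followers.\<close>
        with u px have "None \<in> C (map Some u)"
          by metis
        then show "infinite (E u)"
          by (auto simp: C)
      qed
      finally show ?thesis .
    next
      case (2 w)
      then have w: "range w \<subseteq> A"
        using x by auto
      have px: "prefix (length v) x = map Some v \<longleftrightarrow> prefix (length v) w = v" for v
        unfolding prefix_eq_map_Some_iff prefix_eq_iff by (simp add: 2)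
      have "truncate x \<in> avoid A F \<longleftrightarrow> (\<forall>n. w n \<in> E (prefix n w))"
        by (simp add: 2 InfSeq_in_avoid_iff InfSeq_in_avoid_inf_iff_followers[OF w] E_def)
      also have "\<dots> \<longleftrightarrow> (\<forall>v\<in>lists A. prefix (length v) w = v \<longrightarrow> w (length v) \<in> E v)"
      proof (intro iffI allI ballI impI)
        fix n
        assume "\<forall>v\<in>lists A. prefix (length v) w = v \<longrightarrow> w (length v) \<in> E v"
        from bspec[OF this prefix_in_lists[OF w], of n] show "w n \<in> E (prefix n w)"
          by simp
      qed metis
      \<comment> \<open>No coordinate of \<open>x\<close> is \<open>None\<close>, so membership in
        \<open>C\<close> means being a follower.\<close>
      also have "\<dots> \<longleftrightarrow>
        (\<forall>v\<in>lists A. prefix (length v) x = map Some v \<longrightarrow> x (length v) \<in> C (map Some v))"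
        unfolding px C by (auto simp: 2)
      finally show ?thesis .
    qed
    then show ?thesis by auto
  qed
  moreover have "closedin (product_topology (\<lambda>_. ?K) UNIV) ?R"
  proof (rule closedin_product_prefix_constraints)
    fix p and a :: "'a option"
    assume "p \<in> map Some ` lists A" "a \<in> set p"
    then obtain b where "a = Some b" "b \<in> A" by auto
    then have "openin ?K (Some ` {b})"
      unfolding openin_Alexandroff_compactification_image_Some by simp
    with \<open>a = Some b\<close> show "openin ?K {a}" by simp
  qed (rule closed)
  ultimately show ?thesis
    by (simp add: closedin_shift_topology_infinite[OF False X])
qed

text \<open>Deleting a first letter creates no new subblocks of an infinite sequence, and therefore
  a block loses no followers; the empty block is fixed.\<close>

lemma shift_map_avoid: "shift_map ` avoid A F \<subseteq> avoid A F"
proof safe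
  fix x
  assume x: "x \<in> avoid A F"
  show "shift_map x \<in> avoid A F"
  proof (cases x)
    case (InfSeq w)
    have "cat [w 0] (InfSeq (suffix 1 w)) = InfSeq w"
      by simp
    with x InfSeq show ?thesis
      by (metis InfSeq_in_avoid_iff avoid_inf_cat shift_map.simps(2))
  next
    case (FinSeq u)
    show ?thesis
    proof (cases u)
      case Nil
      with x FinSeq show ?thesis by simp
    next
      case (Cons b v)
      have "followers A F u \<subseteq> followers A F v"
      proof
        fix a assume "a \<in> followers A F u"
        then obtain y where y: "a \<in> A" "y \<in> inf_seqs A" "cat [b] (cat v (cat [a] y)) \<in> avoid_inf A F"
          by (auto simp: followers_def Cons)
        with avoid_inf_cat[OF y(3)] show "a \<in> followers A F v"
          unfolding followers_def by blast
      qed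
      moreover have "u \<in> lists A" "infinite (followers A F u)"
        using x by (simp_all add: FinSeq FinSeq_in_avoid_iff)
      ultimately have "infinite (followers A F v)" "v \<in> lists A"
        using infinite_super by (blast, simp add: Cons)
      then show ?thesis
        by (simp add: FinSeq Cons FinSeq_in_avoid_iff)
    qed
  qed
qed

lemma infinite_extension_avoid: "infinite_extension A (avoid A F)"
  unfolding infinite_extension_def
proof (intro allI impI)
  fix u
  assume "FinSeq u \<in> avoid A F"
  then have "infinite (followers A F u)"
    by (simp add: FinSeq_in_avoid_iff)
  moreover have "followers A F u \<subseteq> {a \<in> A. \<exists>y\<in>full_shift A. cat u (cat [a] y) \<in> avoid A F}"
    by (auto simp: followers_def full_shift_def avoid_def)
  ultimately show "infinite {a \<in> A. \<exists>y\<in>full_shift A. cat u (cat [a] y) \<in> avoid A F}"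
    using finite_subset by blast
qed

section \<open>From a shift space to forbidden blocks\<close>

text \<open>Unless some extension is already infinite, a finite element can be prolonged step by step
  within the space; the limit of this chain lies in the space because it is closed.\<close>

lemma shift_space_infinite_extension:
  assumes "shift_space A X" "FinSeq v \<in> X"
  shows "\<exists>w. InfSeq (v \<frown> w) \<in> X"
proof (rule ccontr)
  assume none: "\<nexists>w. InfSeq (v \<frown> w) \<in> X"
  have closed: "closedin (shift_topology A) X" and ext: "infinite_extension A X"
    and X: "X \<subseteq> full_shift A"
    using assms(1) by (auto simp: shift_space_def)
  \<comment> \<open>The chain \<open>f\<close> of blocks in \<open>X\<close> starts beyond
    \<open>v\<close>; the bound \<open>n \<le> length (f n)\<close> makes its limit
    infinite.\<close>
  have "\<exists>f. \<forall>n. (FinSeq (f n) \<in> X \<and> (\<exists>t. f n = v @ t) \<and> n \<le> length (f n)) \<and>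
      (\<exists>t. f (Suc n) = f n @ t)"
  proof (rule dependent_nat_choice)
    show "\<exists>u. FinSeq u \<in> X \<and> (\<exists>t. u = v @ t) \<and> 0 \<le> length u"
      using assms(2) by auto
  next
    fix u n
    assume u: "FinSeq u \<in> X \<and> (\<exists>t. u = v @ t) \<and> n \<le> length u"
    then obtain t where t: "u = v @ t" by blast
    have "infinite {a \<in> A. \<exists>y\<in>full_shift A. cat u (cat [a] y) \<in> X}"
      using ext u by (auto simp: infinite_extension_def)
    then have "{a \<in> A. \<exists>y\<in>full_shift A. cat u (cat [a] y) \<in> X} \<noteq> {}"
      by (rule infinite_imp_nonempty)
    then obtain a y where y: "cat (u @ [a]) y \<in> X"
      by auto
    \<comment> \<open>An infinite continuation would contradict \<open>none\<close>, so the chain is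
      prolonged by a block.\<close>
    have "y \<noteq> InfSeq w" for w
    proof
      assume "y = InfSeq w"
      with y have "InfSeq (v \<frown> ((t @ [a]) \<frown> w)) \<in> X"
        unfolding conc_conc by (simp add: t del: build_append)
      with none show False by blast
    qed
    then obtain s where s: "y = FinSeq s"
      by (cases y) auto
    show "\<exists>u'. (FinSeq u' \<in> X \<and> (\<exists>t. u' = v @ t) \<and> Suc n \<le> length u') \<and> (\<exists>t. u' = u @ t)"
      by (rule exI[of _ "u @ [a] @ s"]) (use u y s t in auto)
  qed
  then obtain f where f: "\<And>n. FinSeq (f n) \<in> X" "\<And>n. \<exists>t. f n = v @ t" "\<And>n. n \<le> length (f n)"
    and f_step: "\<And>n. \<exists>t. f (Suc n) = f n @ t"
    by blast
  have chain: "\<exists>t. f n = f m @ t" if "m \<le> n" for m n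
    using that
  proof (induction rule: dec_induct)
    case (step n)
    then show ?case
      using f_step[of n] by (metis append.assoc)
  qed simp
  have nth: "f m ! i = f n ! i" if "m \<le> n" "i < length (f m)" for m n i
    using chain[OF that(1)] that(2) by (auto simp: nth_append)
  \<comment> \<open>Index \<open>i\<close> exists in \<open>f (Suc i)\<close>, whose length is at
    least \<open>Suc i\<close>; since the blocks extend each other, any longer member gives the same
    letter.\<close>
  define w where "w i = f (Suc i) ! i" for i
  have w: "w i = f n ! i" if "i < length (f n)" for i n
  proof (cases "Suc i \<le> n")
    case True
    have "i < length (f (Suc i))"
      using f(3)[of "Suc i"] by linarith
    with True show ?thesis
      unfolding w_def by (rule nth)
  next
    case False
    then have "n \<le> Suc i" by simp
    with that show ?thesis
      unfolding w_def by (intro nth[symmetric])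
  qed
  have prefix: "prefix n w = take n (f n)" for n
  proof (rule nth_equalityI)
    show "length (prefix n w) = length (take n (f n))"
      using f(3)[of n] by simp
    show "prefix n w ! i = take n (f n) ! i" if "i < length (prefix n w)" for i
      using that f(3)[of n] w[of i n] by simp
  qed
  have "range w \<subseteq> A"
  proof safe
    fix i
    have "f (Suc i) \<in> lists A"
      using f(1)[of "Suc i"] X by (auto simp: full_shift_def inf_seqs_def fin_seqs_def split: if_splits)
    then show "w i \<in> A"
      using f(3)[of "Suc i"] by (auto simp: w_def)
  qed
  moreover have "\<exists>z. cat (prefix n w) z \<in> X" for n
  proof
    show "cat (prefix n w) (FinSeq (drop n (f n))) \<in> X"
      using f(1) by (simp add: prefix)
  qed
  ultimately have wX: "InfSeq w \<in> X"
    using closed_shift_prefix_limit[OF closed] by blast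
  have "prefix (length v) w = v"
    unfolding prefix_eq_iff
  proof (intro allI impI)
    fix i assume "i < length v"
    moreover obtain t where "f 0 = v @ t"
      using f(2) by blast
    ultimately show "w i = v ! i"
      using w[of i 0] by (simp add: nth_append)
  qed
  then have "w = v \<frown> suffix (length v) w"
    by (metis prefix_suffix)
  with wX none show False
    by metis
qed

text \<open>The infinite part is settled first. The finite part reduces to it, because a
  continuation inside \<open>X\<close> can be taken infinite.\<close>

lemma shift_space_eq_avoid:
  assumes "shift_space A X"
  shows "X = avoid A {u \<in> lists A. \<not> (\<exists>x\<in>X. subblock u x)}"
proof -
  define F where "F = {u \<in> lists A. \<not> (\<exists>x\<in>X. subblock u x)}"
  have closed: "closedin (shift_topology A) X" and ext: "infinite_extension A X"
    and X: "X \<subseteq> full_shift A" and shift: "shift_map ` X \<subseteq> X"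
    using assms by (auto simp: shift_space_def)
  have inf: "InfSeq w \<in> X \<longleftrightarrow> InfSeq w \<in> avoid_inf A F" for w
  proof
    assume "InfSeq w \<in> X"
    moreover from this X have "InfSeq w \<in> inf_seqs A"
      by (auto simp: full_shift_def fin_seqs_def split: if_splits)
    ultimately show "InfSeq w \<in> avoid_inf A F"
      by (auto simp: avoid_inf_def F_def)
  next
    assume w: "InfSeq w \<in> avoid_inf A F"
    then have "range w \<subseteq> A"
      by (auto simp: avoid_inf_def inf_seqs_def)
    moreover have "\<exists>z. cat (prefix n w) z \<in> X" for n
    proof -
      have "InfSeq w = cat [] (cat (prefix n w) (InfSeq (suffix n w)))"
        by simp
      then have "subblock (prefix n w) (InfSeq w)"
        unfolding subblock_def by blast
      then have "prefix n w \<notin> F"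
        using w by (auto simp: avoid_inf_def)
      with prefix_in_lists[OF \<open>range w \<subseteq> A\<close>] obtain x where "x \<in> X" "subblock (prefix n w) x"
        unfolding F_def by blast
      \<comment> \<open>The prefix may occur anywhere in \<open>x\<close>; shift invariance deletes
        what precedes it.\<close>
      then obtain y z where "cat y (cat (prefix n w) z) \<in> X"
        unfolding subblock_def by blast
      then show ?thesis
        using shift_invariant_cat[OF shift] by blast
    qed
    ultimately show "InfSeq w \<in> X"
      using closed_shift_prefix_limit[OF closed] by blast
  qed
  have fin: "FinSeq u \<in> X \<longleftrightarrow> FinSeq u \<in> avoid A F" for u
  proof
    assume u: "FinSeq u \<in> X"
    \<comment> \<open>The extension property may provide a finite \<open>y\<close>, whereas
      \<open>followers\<close> asks for an infinite one;
      \<open>shift_space_infinite_extension\<close> bridges the gap.\<close>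
    have "a \<in> followers A F u" if "a \<in> A" "cat u (cat [a] y) \<in> X" for a y
    proof -
      have "\<exists>w. InfSeq ((u @ [a]) \<frown> w) \<in> X"
      proof (cases y)
        case (FinSeq s)
        with that(2) have "FinSeq ((u @ [a]) @ s) \<in> X" by simp
        then obtain w where "InfSeq (((u @ [a]) @ s) \<frown> w) \<in> X"
          using shift_space_infinite_extension[OF assms] by blast
        then have "InfSeq ((u @ [a]) \<frown> (s \<frown> w)) \<in> X"
          by (simp only: conc_conc)
        then show ?thesis by blast
      qed (use that(2) in auto)
      then obtain w where "cat (u @ [a]) (InfSeq w) \<in> avoid_inf A F"
        using inf by auto
      moreover from this have "InfSeq w \<in> inf_seqs A"
        unfolding avoid_inf_def mem_Collect_eq cat_in_inf_seqs_iff by blast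
      ultimately show ?thesis
        using that(1) unfolding followers_def mem_Collect_eq cat_cat by blast
    qed
    then have "{a \<in> A. \<exists>y\<in>full_shift A. cat u (cat [a] y) \<in> X} \<subseteq> followers A F u"
      by blast
    moreover have "infinite {a \<in> A. \<exists>y\<in>full_shift A. cat u (cat [a] y) \<in> X}"
      using ext u by (auto simp: infinite_extension_def)
    ultimately have "infinite (followers A F u)"
      by (rule infinite_super)
    moreover have "u \<in> lists A"
      using u X by (auto simp: full_shift_def inf_seqs_def fin_seqs_def split: if_splits)
    ultimately show "FinSeq u \<in> avoid A F"
      by (simp add: FinSeq_in_avoid_iff)
  next
    assume "FinSeq u \<in> avoid A F"
    then have "infinite (followers A F u)"
      by (simp add: FinSeq_in_avoid_iff)
    \<comment> \<open>Avoiding sequences lie in \<open>X\<close> by the infinite part, so the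
      compactness argument puts \<open>u\<close> itself into \<open>X\<close>.\<close>
    moreover have "followers A F u \<subseteq> {a \<in> A. \<exists>z. cat u (cat [a] z) \<in> X}"
    proof -
      have "x \<in> X" if "x \<in> avoid_inf A F" for x
        using that inf by (cases x) (auto simp: avoid_inf_def inf_seqs_def)
      then show ?thesis
        unfolding followers_def by blast
    qed
    ultimately show "FinSeq u \<in> X"
      using closed_shift_infinite_followers[OF closed] finite_subset by blast
  qed
  have "x \<in> X \<longleftrightarrow> x \<in> avoid A F" for x
    using inf fin by (cases x) (auto simp: InfSeq_in_avoid_iff)
  then show ?thesis
    unfolding F_def by (rule set_eqI)
qed

theorem theorem3p16:
  fixes A :: "'a set" and X :: "'a sequence set"
  assumes "X \<subseteq> full_shift A"
  shows "shift_space A X \<longleftrightarrow> (\<exists>F. F \<subseteq> lists A \<and> X = avoid A F)"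
proof
  assume "shift_space A X"
  show "\<exists>F. F \<subseteq> lists A \<and> X = avoid A F"
  proof (intro exI conjI)
    show "X = avoid A {u \<in> lists A. \<not> (\<exists>x\<in>X. subblock u x)}"
      by (rule shift_space_eq_avoid[OF \<open>shift_space A X\<close>])
  qed blast
next
  assume "\<exists>F. F \<subseteq> lists A \<and> X = avoid A F"
  then obtain F where F: "X = avoid A F" by blast
  show "shift_space A X"
    using assms unfolding F
    by (simp add: shift_space_def closedin_avoid shift_map_avoid infinite_extension_avoid)
qed

end
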